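(* The fully looped path $P_n^{\circ}$ is Hoffman-London for all $n\ge 1$ and strongly Hoffman-London for all $n\ge 3$.
   Context: The fully looped path $P_n^{\circ}$ is the graph on vertex set $u_1,\ldots,u_n$ with edges $u_iu_{i+1}$ for $1\le i\le n-1$ and a loop $u_iu_i$ for each $1\le i\le n$. For a target graph $H$ (no multiple edges, possibly with loops) and a simple loopless graph $G$, an $H$-coloring of $G$ is a map $f:V(G)\to V(H)$ such that $f(u)\sim_H f(v)$ whenever $u\sim_G v$; $\hom(G,H)$ denotes the number of $H$-colorings of $G$. $\mathcal{T}_N$ is the set of all trees on $N$ vertices (up to isomorphism) and $P_N\in\mathcal{T}_N$ is the (loopless) path on $N$ vertices. $H$ is Hoffman-London if for all $N\ge 1$, $\hom(P_N,H)=\min_{T\in\mathcal{T}_N}\hom(T,H)$; $H$ is strongly Hoffman-London if $\hom(P_N,H)<\hom(T,H)$ for all $N\ge 1$ and all $T\in\mathcal{T}_N\setminus\{P_N\}$. *)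

theory Defs
  imports "Graph_Theory.Graph_Theory" "HOL-Library.FuncSet"
begin

text \<open>
  Undirected graphs without multiple edges are symmetric digraphs without parallel arcs:
  \<^locale>\<open>pair_pseudo_graph\<close> (finite, loops allowed) for targets \<open>H\<close> and
  \<^locale>\<open>pair_graph\<close> (finite, loopless) for sources \<open>G\<close>. A loop at \<open>u\<close> is the arc \<open>(u, u)\<close>.
\<close>

definition H_colorings :: "'a pair_pre_digraph \<Rightarrow> 'b pair_pre_digraph \<Rightarrow> ('a \<Rightarrow> 'b) set" where
  "H_colorings G H =
     {f \<in> pverts G \<rightarrow>\<^sub>E pverts H. \<forall>u v. (u, v) \<in> parcs G \<longrightarrow> (f u, f v) \<in> parcs H}"

definition hom_count :: "'a pair_pre_digraph \<Rightarrow> 'b pair_pre_digraph \<Rightarrow> nat" where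
  "hom_count G H = card (H_colorings G H)"

text \<open>
  \<^const>\<open>Digraph_Component.tree\<close> cannot be used here: it forbids all directed cycles, and in a
  symmetric digraph traversing an edge back and forth is a directed cycle of length 2. The cycles
  of the undirected graph are the directed cycles of length at least 3.
\<close>

definition undirected_tree :: "'a pair_pre_digraph \<Rightarrow> bool" where
  "undirected_tree T \<longleftrightarrow>
     pair_graph T \<and> Digraph_Component.connected (with_proj T) \<and>
     \<not> (\<exists>p. pre_digraph.cycle (with_proj T) p \<and> 3 \<le> length p)"

text \<open>
  The trees on the fixed vertex set \<open>{1..N}\<close>. Every tree on \<open>N\<close> vertices is isomorphic to at least
  one of them, so this set stands for the isomorphism classes (with repetitions).
\<close>

definition trees :: "nat \<Rightarrow> nat pair_pre_digraph set" where
  "trees N = {T. pverts T = {1..N} \<and> undirected_tree T}"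

definition path_graph :: "nat \<Rightarrow> nat pair_pre_digraph" where
  "path_graph n =
     \<lparr>pverts = {1..n}, parcs = {(i, j) \<in> {1..n} \<times> {1..n}. j = i + 1 \<or> i = j + 1}\<rparr>"

definition looped_path :: "nat \<Rightarrow> nat pair_pre_digraph" where
  "looped_path n =
     \<lparr>pverts = {1..n}, parcs = {(i, j) \<in> {1..n} \<times> {1..n}. j = i + 1 \<or> i = j + 1 \<or> i = j}\<rparr>"

definition Hoffman_London :: "'b pair_pre_digraph \<Rightarrow> bool" where
  "Hoffman_London H \<longleftrightarrow>
     (\<forall>N\<ge>1. hom_count (path_graph N) H = Min ((\<lambda>T. hom_count T H) ` trees N))"

definition strongly_Hoffman_London :: "'b pair_pre_digraph \<Rightarrow> bool" where
  "strongly_Hoffman_London H \<longleftrightarrow>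
     (\<forall>N\<ge>1. \<forall>T \<in> trees N. \<not> digraph_iso (with_proj T) (with_proj (path_graph N)) \<longrightarrow>
        hom_count (path_graph N) H < hom_count T H)"

lemma pair_graph_path_graph: "pair_graph (path_graph n)"
proof unfold_locales
  have "parcs (path_graph n) \<subseteq> {1..n} \<times> {1..n}" by (auto simp: path_graph_def)
  then show "finite (parcs (path_graph n))" by (rule finite_subset) simp
qed (auto simp: path_graph_def symmetric_def intro!: symI)

lemma pair_pseudo_graph_looped_path: "pair_pseudo_graph (looped_path n)"
proof unfold_locales
  have "parcs (looped_path n) \<subseteq> {1..n} \<times> {1..n}" by (auto simp: looped_path_def)
  then show "finite (parcs (looped_path n))" by (rule finite_subset) simp
qed (auto simp: looped_path_def symmetric_def intro!: symI)

lemma finite_trees: "finite (trees N)"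
proof (rule finite_subset)
  show "trees N \<subseteq> (\<lambda>E. \<lparr>pverts = {1..N}, parcs = E\<rparr>) ` Pow ({1..N} \<times> {1..N})"
  proof
    fix T assume T: "T \<in> trees N"
    then interpret pair_graph T by (simp add: trees_def undirected_tree_def)
    have V: "pverts T = {1..N}" using T by (simp add: trees_def)
    then have "parcs T \<in> Pow ({1..N} \<times> {1..N})"
      using in_arcsD1 in_arcsD2 by fastforce
    moreover have "T = \<lparr>pverts = {1..N}, parcs = parcs T\<rparr>" using V by simp
    ultimately show "T \<in> (\<lambda>E. \<lparr>pverts = {1..N}, parcs = E\<rparr>) ` Pow ({1..N} \<times> {1..N})" by blast
  qed
qed simp

end

theory Submission
  imports Defs
begin

text \<open>
  Let \<open>M\<close> be the adjacency operator of the looped path and let \<open>w\<^sub>t i\<close> count the colorings of a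
  rooted tree \<open>t\<close> that send the root to \<open>i\<close>. The vectors \<open>w\<^sub>t\<close> are positive, symmetric and increase
  towards the centre of the path, because products and \<open>M\<close> preserve these properties. Any two
  such vectors \<open>b\<close>, \<open>c\<close> are similarly ordered, so
  \<open>2 (\<langle>b c, M\<^sup>q 1\<rangle> - \<langle>b, M\<^sup>q c\<rangle>) = \<Sum>i. M\<^sup>q (\<lambda>j. (b\<^sub>i - b\<^sub>j) (c\<^sub>i - c\<^sub>j)) i \<ge> 0\<close>,
  which is the effect of Csikvari's generalized tree shift. If \<open>t\<close> arises by joining
  the root of a tree \<open>u\<close> with \<open>q + 1\<close> vertices to the root of a tree \<open>s\<close> with \<open>p + 1\<close> vertices, then
  \<open>w\<^sub>t = w\<^sub>s (M w\<^sub>u)\<close>, and replacing first \<open>s\<close> and then \<open>u\<close> by a path gives inductively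
  \<open>\<langle>b, w\<^sub>t\<rangle> \<ge> \<langle>b, (M\<^sup>p 1) (M\<^bsup>q+1\<^esup> 1)\<rangle> \<ge> \<langle>b, M\<^bsup>p+q+1\<^esup> 1\<rangle>\<close> for every such \<open>b\<close>; the case \<open>b = 1\<close> is the
  theorem. For \<open>n \<ge> 3\<close> the inequality is strict when \<open>b\<^sub>1 < b\<^sub>2\<close> and \<open>t\<close> is not a path rooted at an end.
  With \<open>b = M w\<^sub>u\<close> and \<open>b = M w\<^sub>s\<close> this shows that equality for \<open>b = 1\<close> forces \<open>s\<close> and \<open>u\<close> to be paths
  rooted at an end, so that \<open>t\<close> is a path.
\<close>

section \<open>The adjacency operator\<close>

text \<open>Values are integers rather than naturals because the shift argument works with
  differences of vectors.\<close>

definition nbr_sum :: "'a pair_pre_digraph \<Rightarrow> ('a \<Rightarrow> int) \<Rightarrow> 'a \<Rightarrow> int" where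
  "nbr_sum H f i = (\<Sum>j | (i, j) \<in> parcs H. f j)"

context pair_pseudo_graph
begin

lemma finite_nbrs: "finite {j. (i, j) \<in> parcs G}"
  by (rule finite_subset[of _ "snd ` parcs G"]) (force intro: pair_finite_arcs)+

lemma nbr_sum_alt: "nbr_sum G f i = (\<Sum>j\<in>pverts G. if (i, j) \<in> parcs G then f j else 0)"
  unfolding nbr_sum_def sum.inter_filter[OF pair_finite_verts, symmetric]
  by (rule sum.cong) (auto dest: in_arcsD2)

text \<open>The adjacency operator is self-adjoint: both sides are double sums over pairs of
  vertices, exchanged by the symmetry of the arcs.\<close>

lemma sum_mult_nbr_sum:
  "(\<Sum>i\<in>pverts G. f i * nbr_sum G g i) = (\<Sum>i\<in>pverts G. nbr_sum G f i * g i)"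
proof -
  have "(\<Sum>i\<in>pverts G. f i * nbr_sum G g i)
      = (\<Sum>i\<in>pverts G. \<Sum>j\<in>pverts G. if (i, j) \<in> parcs G then f i * g j else 0)"
    by (auto simp: nbr_sum_alt sum_distrib_left intro!: sum.cong)
  also have "\<dots> = (\<Sum>j\<in>pverts G. \<Sum>i\<in>pverts G. if (j, i) \<in> parcs G then f i * g j else 0)"
    by (subst sum.swap) (auto intro!: sum.cong dest: arcs_symmetric)
  also have "\<dots> = (\<Sum>i\<in>pverts G. nbr_sum G f i * g i)"
    by (auto simp: nbr_sum_alt sum_distrib_right intro!: sum.cong)
  finally show ?thesis .
qed

lemma sum_mult_nbr_sum_pow:
  "(\<Sum>i\<in>pverts G. f i * (nbr_sum G ^^ q) g i) = (\<Sum>i\<in>pverts G. (nbr_sum G ^^ q) f i * g i)"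
  by (induction q arbitrary: f) (simp_all add: sum_mult_nbr_sum flip: funpow_swap1)

lemma nbr_sum_pow_nonneg:
  assumes "\<And>j. j \<in> pverts G \<Longrightarrow> 0 \<le> f j" "i \<in> pverts G"
  shows "0 \<le> (nbr_sum G ^^ q) f i"
  using assms(2)
proof (induction q arbitrary: i)
  case (Suc q)
  then show ?case by (auto simp: nbr_sum_def dest: in_arcsD2 intro!: sum_nonneg)
qed (use assms(1) in simp)

end

lemma nbr_sum_pow_add:
  "(nbr_sum H ^^ q) (\<lambda>j. f j + g j) i = (nbr_sum H ^^ q) f i + (nbr_sum H ^^ q) g i"
  by (induction q arbitrary: i) (simp_all add: nbr_sum_def sum.distrib)

lemma nbr_sum_pow_scale: "(nbr_sum H ^^ q) (\<lambda>j. c * f j) i = c * (nbr_sum H ^^ q) f i"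
  by (induction q arbitrary: i) (simp_all add: nbr_sum_def sum_distrib_left)

lemma nbr_sum_pow_diff_mult_diff:
  "(nbr_sum H ^^ q) (\<lambda>j. (b i - b j) * (c i - c j)) i =
     b i * c i * (nbr_sum H ^^ q) (\<lambda>_. 1) i - b i * (nbr_sum H ^^ q) c i
     - c i * (nbr_sum H ^^ q) b i + (nbr_sum H ^^ q) (\<lambda>j. b j * c j) i"
proof -
  have "(\<lambda>j. (b i - b j) * (c i - c j)) =
      (\<lambda>j. (b i * c i * 1 + (- b i) * c j) + ((- c i) * b j + b j * c j))"
    by (auto simp: algebra_simps)
  then show ?thesis
    by (simp only: nbr_sum_pow_add nbr_sum_pow_scale)
qed

text \<open>Summed over \<open>i\<close>, the first and last terms of the expansion agree by
  self-adjointness, and so do the two mixed terms; hence the factor 2.\<close>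

lemma (in pair_pseudo_graph) sum_nbr_sum_pow_diff_mult_diff:
  "(\<Sum>i\<in>pverts G. (nbr_sum G ^^ q) (\<lambda>j. (b i - b j) * (c i - c j)) i) =
     2 * ((\<Sum>i\<in>pverts G. b i * c i * (nbr_sum G ^^ q) (\<lambda>_. 1) i)
          - (\<Sum>i\<in>pverts G. b i * (nbr_sum G ^^ q) c i))"
  using sum_mult_nbr_sum_pow[of c q b] sum_mult_nbr_sum_pow[of "\<lambda>_. 1" q "\<lambda>j. b j * c j"]
  by (simp add: nbr_sum_pow_diff_mult_diff sum.distrib sum_subtractf mult.commute)

section \<open>Symmetric unimodal vectors on the looped path\<close>

text \<open>\<open>\<bar>2 * int i - int n - 1\<bar>\<close> is twice the distance of
  \<open>i\<close> from the midpoint of the path, doubled to stay integral. Equal distances give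
  inequalities both ways, so symmetry is included.\<close>

definition centred :: "nat \<Rightarrow> (nat \<Rightarrow> int) \<Rightarrow> bool" where
  "centred n b \<longleftrightarrow> (\<forall>i\<in>{1..n}. 0 < b i) \<and>
     (\<forall>i\<in>{1..n}. \<forall>j\<in>{1..n}. \<bar>2 * int j - int n - 1\<bar> \<le> \<bar>2 * int i - int n - 1\<bar> \<longrightarrow> b i \<le> b j)"

lemma centredD_pos: "centred n b \<Longrightarrow> i \<in> {1..n} \<Longrightarrow> 0 < b i"
  and centredD_le: "centred n b \<Longrightarrow> i \<in> {1..n} \<Longrightarrow> j \<in> {1..n} \<Longrightarrow>
    \<bar>2 * int j - int n - 1\<bar> \<le> \<bar>2 * int i - int n - 1\<bar> \<Longrightarrow> b i \<le> b j"
  by (auto simp: centred_def)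

lemma centred_1: "centred n (\<lambda>_. 1)"
  by (simp add: centred_def)

lemma centred_mult:
  assumes "centred n b" "centred n c"
  shows "centred n (\<lambda>i. b i * c i)"
proof -
  have "b i * c i \<le> b j * c j"
    if "i \<in> {1..n}" "j \<in> {1..n}" "\<bar>2 * int j - int n - 1\<bar> \<le> \<bar>2 * int i - int n - 1\<bar>" for i j
    using assms[THEN centredD_le, OF that] assms[THEN centredD_pos, OF that(1)]
      assms[THEN centredD_pos, OF that(2)] by (intro mult_mono) auto
  then show ?thesis
    using assms unfolding centred_def by simp
qed

text \<open>Both vectors decrease with the same distance from the centre, so their differences never
  have opposite signs.\<close>

lemma centred_diff_mult_diff_nonneg:
  assumes "centred n b" "centred n c" "i \<in> {1..n}" "j \<in> {1..n}"
  shows "0 \<le> (b i - b j) * (c i - c j)"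
proof (cases "\<bar>2 * int j - int n - 1\<bar> \<le> \<bar>2 * int i - int n - 1\<bar>")
  case True
  then have "b i \<le> b j" "c i \<le> c j" using assms centredD_le by blast+
  then show ?thesis by (intro mult_nonpos_nonpos) auto
next
  case False
  then have "\<bar>2 * int i - int n - 1\<bar> \<le> \<bar>2 * int j - int n - 1\<bar>" by linarith
  then have "b j \<le> b i" "c j \<le> c i" using assms centredD_le by blast+
  then show ?thesis by (intro mult_nonneg_nonneg) auto
qed

lemma pverts_looped_path [simp]: "pverts (looped_path n) = {1..n}"
  by (simp add: looped_path_def)

text \<open>Extension by zero to all integers gives the end vertices the same three-term formula as
  the inner ones.\<close>

lemma nbr_sum_looped_path:
  fixes f :: "nat \<Rightarrow> int"
  assumes "i \<in> {1..n}"
  defines "e \<equiv> \<lambda>k::int. if 1 \<le> k \<and> k \<le> int n then f (nat k) else 0"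
  shows "nbr_sum (looped_path n) f i = e (int i - 1) + e (int i) + e (int i + 1)"
proof -
  have "nbr_sum (looped_path n) f i = (\<Sum>k\<in>{k \<in> {int i - 1, int i, int i + 1}. 1 \<le> k \<and> k \<le> int n}. f (nat k))"
    unfolding nbr_sum_def
    by (rule sum.reindex_bij_witness[of _ nat int]) (use assms(1) in \<open>auto simp: looped_path_def\<close>)
  also have "\<dots> = (\<Sum>k\<in>{int i - 1, int i, int i + 1}. e k)"
    unfolding e_def by (rule sum.inter_filter) simp
  finally show ?thesis by simp
qed

lemma centred_nbr_sum:
  assumes "centred n b"
  shows "centred n (nbr_sum (looped_path n) b)"
proof -
  define e where "e = (\<lambda>k::int. if 1 \<le> k \<and> k \<le> int n then b (nat k) else 0)"
  have eq: "nbr_sum (looped_path n) b i = e (int i - 1) + e (int i) + e (int i + 1)"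
    if "i \<in> {1..n}" for i
    using nbr_sum_looped_path[OF that] unfolding e_def .
  have pos: "0 < b (nat k)" if "1 \<le> k" "k \<le> int n" for k
    using that by (intro centredD_pos[OF assms]) auto
  have nonneg: "0 \<le> e k" for k
    using pos[of k] by (auto simp: e_def)
  \<comment> \<open>The zero extension respects the order as well: positions outside the path are
    farther from the centre than all positions on it.\<close>
  have mono: "e k \<le> e l" if "\<bar>2 * l - int n - 1\<bar> \<le> \<bar>2 * k - int n - 1\<bar>" for k l
  proof (cases "1 \<le> k \<and> k \<le> int n")
    case True
    then have "1 \<le> l \<and> l \<le> int n" using that by linarith
    moreover from this True have "b (nat k) \<le> b (nat l)"
      using that by (intro centredD_le[OF assms]) auto
    ultimately show ?thesis using True by (simp add: e_def)
  next
    case False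
    then have "e k = 0" by (auto simp: e_def)
    then show ?thesis using nonneg by simp
  qed
  have "nbr_sum (looped_path n) b i \<le> nbr_sum (looped_path n) b j"
    if i: "i \<in> {1..n}" and j: "j \<in> {1..n}"
      and le: "\<bar>2 * int j - int n - 1\<bar> \<le> \<bar>2 * int i - int n - 1\<bar>" for i j
  proof -
    \<comment> \<open>The doubled offsets have equal parity, so distinct distances differ by at
      least 2. Hence \<open>j\<close> is \<open>i\<close>, its mirror image, or at least one step
      closer to the centre; each case pairs the three neighbours of \<open>i\<close> with those of
      \<open>j\<close>.\<close>
    consider "i = j" | "int i = int n + 1 - int j"
      | "\<bar>2 * int j - int n - 1\<bar> \<le> 2 * int i - int n - 3"
      | "\<bar>2 * int j - int n - 1\<bar> \<le> - (2 * int i - int n - 1) - 2"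
      using le by linarith
    then show ?thesis
    proof cases
      case 1
      then show ?thesis by simp
    next
      case 2
      then have "e (int i) \<le> e (int j)" "e (int i - 1) \<le> e (int j + 1)" "e (int i + 1) \<le> e (int j - 1)"
        by (auto intro!: mono)
      then show ?thesis using i j by (simp add: eq)
    next
      case 3
      then have "e (int i - 1) \<le> e (int j)" "e (int i) \<le> e (int j - 1)" "e (int i + 1) \<le> e (int j + 1)"
        by (auto intro!: mono)
      then show ?thesis using i j by (simp add: eq)
    next
      case 4
      then have "e (int i + 1) \<le> e (int j)" "e (int i) \<le> e (int j + 1)" "e (int i - 1) \<le> e (int j - 1)"
        by (auto intro!: mono)
      then show ?thesis using i j by (simp add: eq)
    qed
  qed
  moreover have "0 < nbr_sum (looped_path n) b i" if "i \<in> {1..n}" for i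
    using pos[of "int i"] nonneg[of "int i - 1"] nonneg[of "int i + 1"] that
    by (simp add: eq) (simp add: e_def)
  ultimately show ?thesis unfolding centred_def by blast
qed

lemma centred_nbr_sum_pow: "centred n b \<Longrightarrow> centred n ((nbr_sum (looped_path n) ^^ q) b)"
  by (induction q) (simp_all add: centred_nbr_sum)

lemma nbr_sum_looped_path_1: "2 \<le> n \<Longrightarrow> nbr_sum (looped_path n) f 1 = f 1 + f 2"
  using nbr_sum_looped_path[of 1 n f] by simp

text \<open>The two sums differ exactly by \<open>b 3\<close>, which is positive since
  \<open>3 \<le> n\<close>. This is the source of all strict test vectors.\<close>

lemma nbr_sum_1_less_2:
  assumes "centred n b" "3 \<le> n"
  shows "nbr_sum (looped_path n) b 1 < nbr_sum (looped_path n) b 2"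
  using assms centredD_pos[OF assms(1), of 3] by (simp add: nbr_sum_looped_path)

section \<open>The tree shift inequality and its strict form\<close>

lemma tree_shift_le:
  assumes "centred n b" "centred n c"
  shows "(\<Sum>i=1..n. b i * (nbr_sum (looped_path n) ^^ q) c i)
    \<le> (\<Sum>i=1..n. b i * c i * (nbr_sum (looped_path n) ^^ q) (\<lambda>_. 1) i)"
proof -
  interpret pair_pseudo_graph "looped_path n" by (rule pair_pseudo_graph_looped_path)
  have "0 \<le> (\<Sum>i=1..n. (nbr_sum (looped_path n) ^^ q) (\<lambda>j. (b i - b j) * (c i - c j)) i)"
    using assms by (intro sum_nonneg nbr_sum_pow_nonneg centred_diff_mult_diff_nonneg) auto
  then show ?thesis
    using sum_nbr_sum_pow_diff_mult_diff[of q b c] by simp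
qed

text \<open>For exponent 0 both sides coincide, hence \<open>Suc q\<close>. The pair of vertices 1
  and 2 makes the summand at 1 positive.\<close>

lemma tree_shift_less:
  assumes b: "centred n b" "b 1 < b 2" and c: "centred n c" "c 1 < c 2" and n: "3 \<le> n"
  shows "(\<Sum>i=1..n. b i * (nbr_sum (looped_path n) ^^ Suc q) c i)
    < (\<Sum>i=1..n. b i * c i * (nbr_sum (looped_path n) ^^ Suc q) (\<lambda>_. 1) i)"
proof -
  interpret pair_pseudo_graph "looped_path n" by (rule pair_pseudo_graph_looped_path)
  let ?f = "\<lambda>j. (b 1 - b j) * (c 1 - c j)"
  have f: "0 \<le> (nbr_sum (looped_path n) ^^ q) ?f i" if "i \<in> {1..n}" for i q
    using that b c n by (intro nbr_sum_pow_nonneg centred_diff_mult_diff_nonneg) auto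
  \<comment> \<open>One step brings the positive value from vertex 2 to vertex 1, where the loop
    preserves it in all further steps.\<close>
  have pos: "0 < (nbr_sum (looped_path n) ^^ Suc q) ?f 1" for q
  proof (induction q)
    case 0
    have "0 < ?f 2" using b c by (intro mult_neg_neg) auto
    then show ?case using n by (simp add: nbr_sum_looped_path)
  next
    case (Suc q)
    moreover have "0 \<le> (nbr_sum (looped_path n) ^^ Suc q) ?f 2" using n by (intro f) auto
    moreover have "(nbr_sum (looped_path n) ^^ Suc (Suc q)) ?f 1 =
        (nbr_sum (looped_path n) ^^ Suc q) ?f 1 + (nbr_sum (looped_path n) ^^ Suc q) ?f 2"
      unfolding funpow.simps(2)[of "Suc q"] o_apply using n by (intro nbr_sum_looped_path_1) simp
    ultimately show ?case by linarith
  qed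
  have "0 < (\<Sum>i=1..n. (nbr_sum (looped_path n) ^^ Suc q) (\<lambda>j. (b i - b j) * (c i - c j)) i)"
  proof (rule sum_pos2)
    show "0 < (nbr_sum (looped_path n) ^^ Suc q) ?f 1" by (rule pos)
    show "0 \<le> (nbr_sum (looped_path n) ^^ Suc q) (\<lambda>j. (b i - b j) * (c i - c j)) i" if "i \<in> {1..n}" for i
      using that assms by (intro nbr_sum_pow_nonneg centred_diff_mult_diff_nonneg) auto
  qed (use n in auto)
  then show ?thesis
    using sum_nbr_sum_pow_diff_mult_diff[of "Suc q" b c] by simp
qed

section \<open>Rooted trees\<close>

text \<open>\<open>Graft s t\<close> joins the root of \<open>t\<close> by an edge to the root of \<open>s\<close>, which is the new root.\<close>
datatype rooted_tree = Root | Graft rooted_tree rooted_tree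

primrec nodes :: "rooted_tree \<Rightarrow> nat" where
  "nodes Root = 1"
| "nodes (Graft s t) = nodes s + nodes t"

text \<open>A path rooted at an end; the index counts edges, so that it is the exponent in
  \<open>weight_chain\<close>.\<close>

primrec chain :: "nat \<Rightarrow> rooted_tree" where
  "chain 0 = Root"
| "chain (Suc k) = Graft Root (chain k)"

primrec weight :: "'a pair_pre_digraph \<Rightarrow> rooted_tree \<Rightarrow> 'a \<Rightarrow> int" where
  "weight H Root = (\<lambda>_. 1)"
| "weight H (Graft s t) = (\<lambda>i. weight H s i * nbr_sum H (weight H t) i)"

lemma nodes_neq_0 [simp]: "nodes t \<noteq> 0"
  by (induction t) auto

lemma nodes_chain [simp]: "nodes (chain k) = Suc k"
  by (induction k) auto

lemma weight_chain: "weight H (chain k) = (nbr_sum H ^^ k) (\<lambda>_. 1)"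
  by (induction k) auto

lemma centred_weight: "centred n (weight (looped_path n) t)"
  by (induction t) (simp_all add: centred_1 centred_mult centred_nbr_sum)

text \<open>Each form isolates one branch and absorbs the other into the test vector, so that a
  bound for arbitrary test vectors applies to that branch. The second form uses
  self-adjointness.\<close>

lemma sum_mult_weight_Graft:
  "(\<Sum>i=1..n. b i * weight (looped_path n) (Graft s t) i) =
     (\<Sum>i=1..n. b i * nbr_sum (looped_path n) (weight (looped_path n) t) i * weight (looped_path n) s i)"
  "(\<Sum>i=1..n. b i * weight (looped_path n) (Graft s t) i) =
     (\<Sum>i=1..n. nbr_sum (looped_path n) (\<lambda>i. b i * weight (looped_path n) s i) i * weight (looped_path n) t i)"
proof -
  interpret pair_pseudo_graph "looped_path n" by (rule pair_pseudo_graph_looped_path)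
  show "(\<Sum>i=1..n. b i * weight (looped_path n) (Graft s t) i) =
     (\<Sum>i=1..n. b i * nbr_sum (looped_path n) (weight (looped_path n) t) i * weight (looped_path n) s i)"
    by (simp add: mult_ac)
  show "(\<Sum>i=1..n. b i * weight (looped_path n) (Graft s t) i) =
     (\<Sum>i=1..n. nbr_sum (looped_path n) (\<lambda>i. b i * weight (looped_path n) s i) i * weight (looped_path n) t i)"
    using sum_mult_nbr_sum[of "\<lambda>i. b i * weight (looped_path n) s i" "weight (looped_path n) t"]
    by (simp add: mult_ac)
qed

section \<open>Comparison of rooted trees with chains\<close>

lemma sum_weight_chain_le_Graft_chains:
  assumes "centred n b"
  shows "(\<Sum>i=1..n. b i * weight (looped_path n) (chain (Suc (p + q))) i)
    \<le> (\<Sum>i=1..n. b i * weight (looped_path n) (Graft (chain p) (chain q)) i)"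
  using tree_shift_le[OF assms centred_nbr_sum_pow[OF centred_1], of p "Suc q"]
  by (simp add: weight_chain mult_ac funpow_add funpow_swap1)

text \<open>The first chain has an edge, since otherwise the graft would itself be a chain. The
  vector \<open>c\<close> of the shift is \<open>M\<close> applied to the weight of
  \<open>chain q\<close>, which makes it strict between 1 and 2.\<close>

lemma sum_weight_chain_less_Graft_chains:
  assumes "centred n b" "b 1 < b 2" "3 \<le> n"
  shows "(\<Sum>i=1..n. b i * weight (looped_path n) (chain (Suc (Suc p + q))) i)
    < (\<Sum>i=1..n. b i * weight (looped_path n) (Graft (chain (Suc p)) (chain q)) i)"
  using tree_shift_less[OF assms(1,2) centred_nbr_sum_pow[OF centred_1], of "Suc q" p]
    nbr_sum_1_less_2[OF centred_nbr_sum_pow[OF centred_1], of n q] assms(3)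
  by (simp add: weight_chain mult_ac funpow_add funpow_swap1)

lemma sum_weight_chain_le:
  assumes "centred n b" "nodes t = Suc k"
  shows "(\<Sum>i=1..n. b i * weight (looped_path n) (chain k) i)
    \<le> (\<Sum>i=1..n. b i * weight (looped_path n) t i)"
  using assms
proof (induction t arbitrary: b k)
  case (Graft s t)
  obtain p q where p: "nodes s = Suc p" and q: "nodes t = Suc q"
    using nodes_neq_0 by (metis not0_implies_Suc)
  have k: "k = Suc (p + q)" using Graft.prems p q by simp
  let ?S = "\<lambda>t. \<Sum>i=1..n. b i * weight (looped_path n) t i"
  have "?S (chain k) \<le> ?S (Graft (chain p) (chain q))"
    unfolding k by (rule sum_weight_chain_le_Graft_chains) fact
  also have "\<dots> \<le> ?S (Graft (chain p) t)"
    unfolding sum_mult_weight_Graft(2)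
    by (intro Graft.IH(2) centred_nbr_sum centred_mult centred_weight Graft.prems q)
  also have "\<dots> \<le> ?S (Graft s t)"
    unfolding sum_mult_weight_Graft(1)
    by (intro Graft.IH(1) centred_nbr_sum centred_mult centred_weight Graft.prems p)
  finally show ?case .
qed simp

lemma sum_weight_chain_less:
  assumes "centred n b" "b 1 < b 2" "3 \<le> n" "nodes t = Suc k" "t \<noteq> chain k"
  shows "(\<Sum>i=1..n. b i * weight (looped_path n) (chain k) i)
    < (\<Sum>i=1..n. b i * weight (looped_path n) t i)"
  using assms
proof (induction t arbitrary: b k)
  case (Graft s t)
  obtain p q where p: "nodes s = Suc p" and q: "nodes t = Suc q"
    using nodes_neq_0 by (metis not0_implies_Suc)
  have k: "k = Suc (p + q)" using Graft.prems p q by simp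
  let ?S = "\<lambda>t. \<Sum>i=1..n. b i * weight (looped_path n) t i"
  have s: "?S (Graft (chain p) t) \<le> ?S (Graft s t)"
    unfolding sum_mult_weight_Graft(1)
    by (intro sum_weight_chain_le centred_nbr_sum centred_mult centred_weight Graft.prems p)
  show ?case
  proof (cases p)
    \<comment> \<open>Merging a single node with a chain gains nothing, so strictness must come from
      \<open>t\<close>, tested against \<open>nbr_sum (looped_path n) b\<close>.\<close>
    case 0
    then have "s = Root" using p by (cases s) (auto simp: add_is_1)
    then have "t \<noteq> chain q" using Graft.prems 0 k by auto
    then have "(\<Sum>i=1..n. nbr_sum (looped_path n) b i * weight (looped_path n) (chain q) i)
        < (\<Sum>i=1..n. nbr_sum (looped_path n) b i * weight (looped_path n) t i)"
      using Graft.prems q by (intro Graft.IH(2) centred_nbr_sum nbr_sum_1_less_2)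
    then show ?thesis
      using sum_mult_weight_Graft(2)[of b n Root] \<open>s = Root\<close> 0 k by simp
  next
    case (Suc p')
    \<comment> \<open>Here the merge is strict, and weak bounds suffice for replacing the
      branches.\<close>
    have "?S (chain k) < ?S (Graft (chain p) (chain q))"
      unfolding k Suc by (rule sum_weight_chain_less_Graft_chains) fact+
    also have "\<dots> \<le> ?S (Graft (chain p) t)"
      unfolding sum_mult_weight_Graft(2)
      by (intro sum_weight_chain_le centred_nbr_sum centred_mult centred_weight Graft.prems q)
    also note s
    finally show ?thesis .
  qed
qed simp

text \<open>The excluded shapes are paths, with the root anywhere. The constant test vector is not
  strict between 1 and 2, but applying \<open>M\<close> across the grafting edge produces a strict
  one for whichever branch is not a chain.\<close>

lemma sum_weight_chain_less_unrooted:
  assumes "3 \<le> n" "nodes t = Suc k" "t \<noteq> Root" "\<And>p q. t \<noteq> Graft (chain p) (chain q)"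
  shows "(\<Sum>i=1..n. weight (looped_path n) (chain k) i) < (\<Sum>i=1..n. weight (looped_path n) t i)"
proof -
  obtain s u where t: "t = Graft s u" using assms(3) by (cases t) auto
  obtain p q where p: "nodes s = Suc p" and q: "nodes u = Suc q"
    using nodes_neq_0 by (metis not0_implies_Suc)
  have k: "k = Suc (p + q)" using assms(2) p q t by simp
  let ?S = "\<lambda>t. \<Sum>i=1..n. 1 * weight (looped_path n) t i"
  have le1: "?S (chain k) \<le> ?S (Graft (chain p) (chain q))"
    unfolding k by (rule sum_weight_chain_le_Graft_chains) (rule centred_1)
  have le2: "?S (Graft (chain p) (chain q)) \<le> ?S (Graft (chain p) u)"
    unfolding sum_mult_weight_Graft(2)
    by (intro sum_weight_chain_le centred_nbr_sum centred_mult centred_weight centred_1 q)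
  have le3: "?S (Graft (chain p) u) \<le> ?S (Graft s u)"
    unfolding sum_mult_weight_Graft(1)
    by (intro sum_weight_chain_le centred_nbr_sum centred_mult centred_weight centred_1 p)
  have "?S (chain k) < ?S (Graft s u)"
  proof (cases "s = chain p")
    case True
    then have "u \<noteq> chain q" using assms(4) t by blast
    then have "?S (Graft (chain p) (chain q)) < ?S (Graft (chain p) u)"
      unfolding sum_mult_weight_Graft(2)
      by (intro sum_weight_chain_less centred_nbr_sum nbr_sum_1_less_2 centred_mult
          centred_weight centred_1 assms q)
    then show ?thesis using le1 le3 by linarith
  next
    case False
    then have "?S (Graft (chain p) u) < ?S (Graft s u)"
      unfolding sum_mult_weight_Graft(1)
      using assms(1) p nbr_sum_1_less_2[OF centred_weight assms(1)]
      by (intro sum_weight_chain_less centred_mult centred_nbr_sum centred_weight centred_1) auto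
    then show ?thesis using le1 le2 by linarith
  qed
  then show ?thesis by (simp add: t)
qed

section \<open>Colorings of rooted trees\<close>

text \<open>A relation rather than a function: the order of grafting is not determined by the graph,
  so one rooted tree may have several shapes.\<close>

inductive tree_on :: "rooted_tree \<Rightarrow> 'a \<Rightarrow> 'a set \<Rightarrow> 'a rel \<Rightarrow> bool" where
  tree_on_Root: "tree_on Root r {r} {}"
| tree_on_Graft: "tree_on s r V E \<Longrightarrow> tree_on t r' V' E' \<Longrightarrow> V \<inter> V' = {} \<Longrightarrow>
    tree_on (Graft s t) r (V \<union> V') ({(r, r'), (r', r)} \<union> (E \<union> E'))"

inductive_cases tree_on_RootE: "tree_on Root r V E"
inductive_cases tree_on_GraftE: "tree_on (Graft s t) r V E"

lemma tree_on_finite: "tree_on t r V E \<Longrightarrow> finite V"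
  by (induction rule: tree_on.induct) auto

lemma tree_on_root_in: "tree_on t r V E \<Longrightarrow> r \<in> V"
  by (induction rule: tree_on.induct) auto

lemma tree_on_subset: "tree_on t r V E \<Longrightarrow> E \<subseteq> V \<times> V"
  by (induction rule: tree_on.induct) (auto dest: tree_on_root_in)

lemma tree_on_card: "tree_on t r V E \<Longrightarrow> card V = nodes t"
  by (induction rule: tree_on.induct) (auto simp: card_Un_disjoint tree_on_finite)

context pair_pseudo_graph
begin

lemma finite_H_colorings: "finite V \<Longrightarrow> finite (H_colorings \<lparr>pverts = V, parcs = E\<rparr> G)"
  by (rule finite_subset[of _ "V \<rightarrow>\<^sub>E pverts G"])
    (auto simp: H_colorings_def pair_finite_verts intro: finite_PiE)

text \<open>Cutting the grafting edge leaves independent colorings of the two parts, linked only by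
  the adjacency of their root colors.\<close>

lemma card_H_colorings_tree_on:
  assumes "tree_on t r V E" "i \<in> pverts G"
  shows "int (card {f \<in> H_colorings \<lparr>pverts = V, parcs = E\<rparr> G. f r = i}) = weight G t i"
  using assms
proof (induction arbitrary: i rule: tree_on.induct)
  case (tree_on_Root r)
  then have "{f \<in> H_colorings \<lparr>pverts = {r}, parcs = {}\<rparr> G. f r = i} = {\<lambda>x\<in>{r}. i}"
    by (auto simp: H_colorings_def PiE_def extensional_def fun_eq_iff)
  then show ?case by simp
next
  case (tree_on_Graft s r V E t r' V' E')
  let ?C = "\<lambda>V E. H_colorings \<lparr>pverts = V, parcs = E\<rparr> G"
  let ?W = "V \<union> V'" and ?F = "{(r, r'), (r', r)} \<union> (E \<union> E')"
  let ?P = "SIGMA j:{j. (i, j) \<in> parcs G}. {f \<in> ?C V E. f r = i} \<times> {f \<in> ?C V' E'. f r' = j}"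
  note sub = tree_on_subset[OF tree_on_Graft.hyps(1)] tree_on_subset[OF tree_on_Graft.hyps(2)]
  note root = tree_on_root_in[OF tree_on_Graft.hyps(1)] tree_on_root_in[OF tree_on_Graft.hyps(2)]
  have "bij_betw (\<lambda>f. (f r', restrict f V, restrict f V')) {f \<in> ?C ?W ?F. f r = i} ?P"
  \<comment> \<open>Outside \<open>V\<close> the glued map follows \<open>h\<close>, which is
    \<open>undefined\<close> off \<open>V'\<close>; so it remains extensional.\<close>
  proof (rule bij_betw_byWitness[where f' = "\<lambda>(j, g, h) x. if x \<in> V then g x else h x"])
    show "\<forall>f\<in>{f \<in> ?C ?W ?F. f r = i}.
      (case (f r', restrict f V, restrict f V') of (j, g, h) \<Rightarrow> \<lambda>x. if x \<in> V then g x else h x) = f"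
      by (auto simp: H_colorings_def fun_eq_iff PiE_def extensional_def)
    show "\<forall>p\<in>?P. (\<lambda>f. (f r', restrict f V, restrict f V'))
        (case p of (j, g, h) \<Rightarrow> \<lambda>x. if x \<in> V then g x else h x) = p"
      using tree_on_Graft.hyps(3) root
      by (auto simp: H_colorings_def fun_eq_iff PiE_def extensional_def restrict_def)
    show "(\<lambda>f. (f r', restrict f V, restrict f V')) ` {f \<in> ?C ?W ?F. f r = i} \<subseteq> ?P"
      using sub root by (auto simp: H_colorings_def PiE_def Pi_def)
    show "(\<lambda>(j, g, h) x. if x \<in> V then g x else h x) ` ?P \<subseteq> {f \<in> ?C ?W ?F. f r = i}"
    proof (rule image_subsetI)
      fix p assume "p \<in> ?P"
      then obtain j g h where p: "p = (j, g, h)" and ij: "(i, j) \<in> parcs G"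
        and g: "g \<in> ?C V E" "g r = i" and h: "h \<in> ?C V' E'" "h r' = j" by blast
      let ?f = "\<lambda>x. if x \<in> V then g x else h x"
      have V': "x \<notin> V" if "x \<in> V'" for x using that tree_on_Graft.hyps(3) by blast
      have "?f \<in> ?W \<rightarrow>\<^sub>E pverts G"
        using g h by (auto simp: H_colorings_def PiE_def Pi_def extensional_def)
      moreover have "(?f u, ?f v) \<in> parcs G" if "(u, v) \<in> ?F" for u v
        using that ij g h root sub V' arcs_symmetric[OF ij] by (auto simp: H_colorings_def)
      ultimately have "?f \<in> ?C ?W ?F"
        by (simp only: H_colorings_def pair_pre_digraph.select_convs mem_Collect_eq) blast
      then show "(case p of (j, g, h) \<Rightarrow> \<lambda>x. if x \<in> V then g x else h x)
          \<in> {f \<in> ?C ?W ?F. f r = i}"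
        using p g root by simp
    qed
  qed
  then have "card {f \<in> ?C ?W ?F. f r = i} = card ?P" by (rule bij_betw_same_card)
  also have "\<dots> = (\<Sum>j | (i, j) \<in> parcs G.
      card {f \<in> ?C V E. f r = i} * card {f \<in> ?C V' E'. f r' = j})"
    using finite_H_colorings[OF tree_on_finite[OF tree_on_Graft.hyps(1)], of E]
      finite_H_colorings[OF tree_on_finite[OF tree_on_Graft.hyps(2)], of E']
    by (subst card_SigmaI) (simp_all add: finite_nbrs card_cartesian_product)
  finally have "int (card {f \<in> ?C ?W ?F. f r = i}) = (\<Sum>j | (i, j) \<in> parcs G.
      int (card {f \<in> ?C V E. f r = i}) * int (card {f \<in> ?C V' E'. f r' = j}))"
    by simp
  also have "\<dots> = (\<Sum>j | (i, j) \<in> parcs G. weight G s i * weight G t j)"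
    using tree_on_Graft.IH(2)[OF in_arcsD2] tree_on_Graft.IH(1)[OF tree_on_Graft.prems]
    by (intro sum.cong) simp_all
  also have "\<dots> = weight G (Graft s t) i"
    by (simp add: nbr_sum_def sum_distrib_left)
  finally show ?case .
qed

lemma hom_count_tree_on:
  assumes "tree_on t r (pverts T) (parcs T)"
  shows "int (hom_count T G) = (\<Sum>i\<in>pverts G. weight G t i)"
proof -
  have T: "H_colorings \<lparr>pverts = pverts T, parcs = parcs T\<rparr> G = H_colorings T G"
    by (simp add: H_colorings_def)
  have fin: "finite (H_colorings T G)"
    using finite_H_colorings[OF tree_on_finite[OF assms], of "parcs T"] T by simp
  have "H_colorings T G = (\<Union>i\<in>pverts G. {f \<in> H_colorings T G. f r = i})"
    using tree_on_root_in[OF assms] by (auto simp: H_colorings_def)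
  then have "hom_count T G = card (\<Union>i\<in>pverts G. {f \<in> H_colorings T G. f r = i})"
    by (simp add: hom_count_def)
  also have "\<dots> = (\<Sum>i\<in>pverts G. card {f \<in> H_colorings T G. f r = i})"
    using fin by (intro card_UN_disjoint) (auto simp: pair_finite_verts)
  finally show ?thesis
    using card_H_colorings_tree_on[OF assms] T by simp
qed

end

section \<open>Undirected trees as rooted trees\<close>

text \<open>Acyclicity in terms of reachability; an edge is removed together with its reverse arc.
  In this form it passes to subrelations and directly yields the splitting at an edge.\<close>

definition all_bridges :: "'a rel \<Rightarrow> bool" where
  "all_bridges E \<longleftrightarrow> (\<forall>u v. (u, v) \<in> E \<longrightarrow> (u, v) \<notin> (E - {(u, v), (v, u)})\<^sup>*)"

lemma all_bridges_mono:
  assumes "all_bridges E" "F \<subseteq> E"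
  shows "all_bridges F"
proof -
  have "(F - {(u, v), (v, u)})\<^sup>* \<subseteq> (E - {(u, v), (v, u)})\<^sup>*" for u v
    using assms(2) by (intro rtrancl_mono) auto
  then show ?thesis using assms unfolding all_bridges_def by blast
qed

lemma rtrancl_restrict_reachable:
  assumes "(r, v) \<in> F\<^sup>*"
  shows "(r, v) \<in> (F \<inter> (F\<^sup>* `` {r}) \<times> (F\<^sup>* `` {r}))\<^sup>*"
  using assms
proof (induction rule: rtrancl_induct)
  case (step y z)
  then have "(y, z) \<in> F \<inter> (F\<^sup>* `` {r}) \<times> (F\<^sup>* `` {r})"
    by (auto intro: rtrancl_into_rtrancl)
  then show ?case using step.IH by (rule rtrancl_into_rtrancl[rotated])
qed simp

text \<open>Deleting an edge at the root separates its ends; the two components are smaller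
  instances, and grafting them restores the edge.\<close>

lemma tree_on_exists:
  assumes "finite V" "E \<subseteq> V \<times> V" "sym E" "all_bridges E" "r \<in> V" "V \<subseteq> E\<^sup>* `` {r}"
  shows "\<exists>t. tree_on t r V E"
  using assms
proof (induction "card V" arbitrary: V E r rule: less_induct)
  case less
  note E = \<open>E \<subseteq> V \<times> V\<close> \<open>sym E\<close> \<open>all_bridges E\<close>
  show ?case
  proof (cases "\<exists>s. (r, s) \<in> E")
    case False
    then have "E\<^sup>* `` {r} = {r}" by (auto elim: converse_rtranclE)
    then have "V = {r}" using less.prems by auto
    moreover from this have "E = {}" using E(1) False by auto
    ultimately show ?thesis using tree_on_Root by metis
  next
    case True
    then obtain s where rs: "(r, s) \<in> E" by blast
    define F where "F = E - {(r, s), (s, r)}"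
    define R where "R = (\<lambda>x. F\<^sup>* `` {x})"
    define A where "A = (\<lambda>x. F \<inter> R x \<times> R x)"
    have sr: "(s, r) \<in> E" using rs E(2) by (rule symD[rotated])
    have symF: "sym F" using E(2) by (auto simp: F_def sym_def)
    have nrs: "(r, s) \<notin> F\<^sup>*" using rs E(3) by (auto simp: all_bridges_def F_def)
    then have nsr: "(s, r) \<notin> F\<^sup>*" using symF by (metis sym_rtrancl symD)
    have disj: "R r \<inter> R s = {}"
    proof -
      have False if "(r, x) \<in> F\<^sup>*" "(s, x) \<in> F\<^sup>*" for x
        using that nrs symF by (metis sym_rtrancl symD rtrancl_trans)
      then show ?thesis by (auto simp: R_def)
    qed
    have RV: "R x \<subseteq> V" if "x \<in> V" for x
    proof
      fix y assume "y \<in> R x"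
      then have "(x, y) \<in> F\<^sup>*" by (simp add: R_def)
      then show "y \<in> V" using that E(1) by (induction rule: rtrancl_induct) (auto simp: F_def)
    qed
    have sV: "s \<in> V" using rs E(1) by auto
    have V: "V = R r \<union> R s"
    proof
      show "V \<subseteq> R r \<union> R s"
      proof
        fix y assume "y \<in> V"
        then have "(r, y) \<in> E\<^sup>*" using less.prems by auto
        then show "y \<in> R r \<union> R s"
        proof (induction rule: rtrancl_induct)
          case (step y z)
          \<comment> \<open>A step outside \<open>F\<close> uses the deleted edge and therefore ends
            at \<open>r\<close> or \<open>s\<close>.\<close>
          then show ?case
            by (cases "(y, z) \<in> F") (auto simp: R_def F_def intro: rtrancl_into_rtrancl)
        qed (simp add: R_def)
      qed
    qed (use RV less.prems sV in auto)
    have "A r \<union> A s = F"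
    proof
      show "F \<subseteq> A r \<union> A s"
      proof
        fix p assume p: "p \<in> F"
        then obtain u v where uv: "p = (u, v)" by (cases p)
        then have "u \<in> R r \<union> R s" using p E(1) V by (auto simp: F_def)
        then show "p \<in> A r \<union> A s" using p uv by (auto simp: A_def R_def intro: rtrancl_into_rtrancl)
      qed
    qed (auto simp: A_def)
    then have E_eq: "E = {(r, s), (s, r)} \<union> (A r \<union> A s)" using rs sr by (auto simp: F_def)
    have part: "\<exists>t. tree_on t x (R x) (A x)" if x: "x \<in> V" and "R x \<noteq> V" for x
    proof (rule less.hyps)
      have "R x \<subset> V" using RV[OF x] that(2) by blast
      then show "card (R x) < card V" using less.prems by (intro psubset_card_mono)
      show "finite (R x)" using RV[OF x] less.prems finite_subset by blast
      show "all_bridges (A x)" using E(3) by (rule all_bridges_mono) (auto simp: A_def F_def)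
      show "sym (A x)" using symF by (auto simp: A_def sym_def)
      show "R x \<subseteq> (A x)\<^sup>* `` {x}"
        unfolding A_def R_def by (auto intro: rtrancl_restrict_reachable)
    qed (auto simp: A_def R_def)
    \<comment> \<open>Each component misses the other end of the deleted edge.\<close>
    have "R r \<noteq> V" "R s \<noteq> V"
      using nrs nsr sV \<open>r \<in> V\<close> by (auto simp: R_def)
    then obtain t u where "tree_on t r (R r) (A r)" "tree_on u s (R s) (A s)"
      using part[OF \<open>r \<in> V\<close>] part[OF sV] by blast
    from tree_on_Graft[OF this disj] show ?thesis
      unfolding E_eq[symmetric] V[symmetric] by (rule exI)
  qed
qed

lemma pair_wf_digraphI: "E \<subseteq> V \<times> V \<Longrightarrow> pair_wf_digraph \<lparr>pverts = V, parcs = E\<rparr>"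
  by unfold_locales auto

text \<open>A path from \<open>u\<close> to \<open>v\<close> that avoids the edge is closed to a
  cycle by the arc \<open>(v, u)\<close>.\<close>

lemma undirected_tree_all_bridges:
  assumes "undirected_tree T"
  shows "all_bridges (parcs T)"
proof -
  interpret T: pair_graph T using assms by (simp add: undirected_tree_def)
  have False if uv: "(u, v) \<in> parcs T" and path: "(u, v) \<in> (parcs T - {(u, v), (v, u)})\<^sup>*" for u v
  proof -
    define G where "G = \<lparr>pverts = pverts T, parcs = parcs T - {(u, v), (v, u)}\<rparr>"
    interpret G: pair_wf_digraph G
      unfolding G_def by (rule pair_wf_digraphI) (auto dest: T.in_arcsD1 T.in_arcsD2)
    have ne: "u \<noteq> v" using uv T.no_loops' by blast
    have "(u, v) \<in> (parcs G)\<^sup>+"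
      using path ne by (simp add: G_def rtrancl_eq_or_trancl)
    then have "u \<rightarrow>\<^sup>*\<^bsub>with_proj G\<^esub> v" by (intro G.reachable1_reachable)
    then obtain p where p: "G.apath u p v" by (auto simp: G.reachable_apath)
    then have "set p \<subseteq> parcs G" and cas: "pcas u p v" and dist: "distinct (pawalk_verts u p)"
      by (simp_all add: G.apath_def G.awalk_def)
    then have sub: "set p \<subseteq> parcs T" "(u, v) \<notin> set p" by (auto simp: G_def)
    have "T.awalk v ((v, u) # p) v"
      using sub cas T.arcs_symmetric[OF uv] T.in_arcsD2[OF uv] by (auto simp: T.awalk_def)
    then have "T.cycle ((v, u) # p)"
      unfolding T.cycle_def using dist by (intro exI[of _ v]) simp
    \<comment> \<open>\<open>p\<close> is nonempty as \<open>u \<noteq> v\<close>, and it is not a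
      single arc, which would have to be \<open>(u, v)\<close>.\<close>
    moreover have "3 \<le> length ((v, u) # p)"
      using cas ne sub(2) by (cases p; cases "tl p") auto
    ultimately show False using assms unfolding undirected_tree_def by blast
  qed
  then show ?thesis by (auto simp: all_bridges_def)
qed

lemma tree_on_undirected_tree:
  assumes "undirected_tree T" "r \<in> pverts T"
  shows "\<exists>t. tree_on t r (pverts T) (parcs T)"
proof (rule tree_on_exists)
  interpret T: pair_graph T using assms by (simp add: undirected_tree_def)
  show "finite (pverts T)" by (rule T.pair_finite_verts)
  show "parcs T \<subseteq> pverts T \<times> pverts T" by (auto dest: T.in_arcsD1 T.in_arcsD2)
  show "sym (parcs T)" using T.arcs_symmetric by (auto intro: symI)
  show "all_bridges (parcs T)" using assms(1) by (rule undirected_tree_all_bridges)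
  show "r \<in> pverts T" by fact
  have "strongly_connected (with_proj T)"
    using assms(1) by (intro T.symmetric_connected_imp_strongly_connected T.sym_arcs)
      (simp add: undirected_tree_def)
  then have "r \<rightarrow>\<^sup>*\<^bsub>with_proj T\<^esub> v" if "v \<in> pverts T" for v
    using assms(2) that by (simp add: strongly_connected_def)
  from reachable_rtranclI[OF this] show "pverts T \<subseteq> (parcs T)\<^sup>* `` {r}"
    by auto
qed

section \<open>Paths\<close>

fun path_arcs :: "'a list \<Rightarrow> 'a rel" where
  "path_arcs (x # y # zs) = {(x, y), (y, x)} \<union> path_arcs (y # zs)"
| "path_arcs _ = {}"

lemma path_arcs_append:
  assumes "xs \<noteq> []" "ys \<noteq> []"
  shows "path_arcs (xs @ ys) = {(last xs, hd ys), (hd ys, last xs)} \<union> (path_arcs xs \<union> path_arcs ys)"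
  using assms
proof (induction xs rule: path_arcs.induct)
  case ("2_2" x)
  then show ?case by (cases ys) auto
qed auto

lemma path_arcs_rev: "path_arcs (rev xs) = path_arcs xs"
proof (induction xs rule: path_arcs.induct)
  case (1 x y zs)
  have "path_arcs (rev (x # y # zs)) = path_arcs (rev (y # zs) @ [x])" by simp
  also have "\<dots> = {(y, x), (x, y)} \<union> path_arcs (rev (y # zs))"
    by (subst path_arcs_append) auto
  finally show ?case using 1 by auto
qed auto

lemma path_arcs_map: "path_arcs (map f xs) = map_prod f f ` path_arcs xs"
  by (induction xs rule: path_arcs.induct) auto

lemma path_arcs_subset: "path_arcs xs \<subseteq> set xs \<times> set xs"
  by (induction xs rule: path_arcs.induct) auto

lemma path_arcs_upt: "path_arcs [1..<Suc N] = parcs (path_graph N)"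
proof (induction N)
  case (Suc N)
  show ?case
  proof (cases N)
    case (Suc M)
    have "path_arcs [1..<Suc (Suc N)] = {(N, Suc N), (Suc N, N)} \<union> parcs (path_graph N)"
      using Suc.IH path_arcs_append[of "[1..<Suc N]" "[Suc N]"] Suc by simp
    also have "\<dots> = parcs (path_graph (Suc N))"
      using Suc by (auto simp: path_graph_def)
    finally show ?thesis .
  qed (auto simp: path_graph_def)
qed (simp add: path_graph_def)

lemma tree_on_chain_path:
  assumes "distinct xs" "xs \<noteq> []"
  shows "tree_on (chain (length xs - 1)) (hd xs) (set xs) (path_arcs xs)"
  using assms
proof (induction xs rule: path_arcs.induct)
  case (1 x y zs)
  then have "tree_on (Graft Root (chain (length zs))) x ({x} \<union> set (y # zs))
      ({(x, y), (y, x)} \<union> ({} \<union> path_arcs (y # zs)))"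
    by (intro tree_on_Graft tree_on_Root) auto
  then show ?case by (simp add: insert_commute)
qed (auto intro: tree_on_Root)

lemma tree_on_chainD:
  assumes "tree_on (chain k) r V E"
  shows "\<exists>xs. distinct xs \<and> xs \<noteq> [] \<and> hd xs = r \<and> V = set xs \<and> E = path_arcs xs"
  using assms
proof (induction k arbitrary: r V E)
  case 0
  then have "V = {r}" "E = {}" by (auto elim: tree_on_RootE)
  then show ?case by (intro exI[of _ "[r]"]) simp
next
  case (Suc k)
  then obtain V' r' E' where *: "V = {r} \<union> V'" "tree_on (chain k) r' V' E'" "r \<notin> V'"
    "E = {(r, r'), (r', r)} \<union> E'"
    by (auto elim!: tree_on_GraftE tree_on_RootE)
  then obtain xs where "distinct xs" "xs \<noteq> []" "hd xs = r'" "V' = set xs" "E' = path_arcs xs"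
    using Suc.IH by blast
  then show ?case using * by (intro exI[of _ "r # xs"]) (cases xs; auto)
qed

lemma tree_on_Graft_chainsD:
  assumes "tree_on (Graft (chain p) (chain q)) r V E"
  shows "\<exists>xs. distinct xs \<and> V = set xs \<and> E = path_arcs xs"
proof -
  from assms obtain V1 E1 V2 E2 s where *: "tree_on (chain p) r V1 E1" "tree_on (chain q) s V2 E2"
    "V = V1 \<union> V2" "V1 \<inter> V2 = {}" "E = {(r, s), (s, r)} \<union> (E1 \<union> E2)"
    by (auto elim!: tree_on_GraftE)
  obtain xs where xs: "distinct xs" "xs \<noteq> []" "hd xs = r" "V1 = set xs" "E1 = path_arcs xs"
    using tree_on_chainD[OF *(1)] by blast
  obtain ys where ys: "distinct ys" "ys \<noteq> []" "hd ys = s" "V2 = set ys" "E2 = path_arcs ys"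
    using tree_on_chainD[OF *(2)] by blast
  \<comment> \<open>Reversal puts \<open>r\<close> at the end of the first list, next to
    \<open>s\<close>, so the junction is the grafting edge.\<close>
  have "path_arcs (rev xs @ ys) = E"
    using xs ys * by (simp add: path_arcs_append path_arcs_rev last_rev)
  then show ?thesis
    using xs ys * by (intro exI[of _ "rev xs @ ys"]) auto
qed

lemma digraph_iso_path_graph:
  assumes "pair_wf_digraph T" "pverts T = set xs" "parcs T = path_arcs xs"
    "distinct xs" "length xs = N"
  shows "digraph_iso (with_proj T) (with_proj (path_graph N))"
proof -
  interpret T: pair_wf_digraph T by fact
  \<comment> \<open>\<open>g\<close> maps each entry of the list to its position, counted from
    1.\<close>
  define g where "g = (\<lambda>x. the (map_of (zip xs [1..<Suc N]) x))"
  have map: "map g xs = [1..<Suc N]"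
    using assms(4,5) by (intro nth_equalityI) (auto simp: g_def map_of_zip_nth simp del: upt_Suc)
  have inj: "inj_on g (set xs)"
    using distinct_map[of g xs] map by (simp del: upt_Suc)
  define f where "f = \<lparr>iso_verts = g, iso_arcs = map_prod g g, iso_head = snd, iso_tail = fst\<rparr>"
  have "T.digraph_isomorphism f"
  proof -
    have "inj_on (map_prod g g) (path_arcs xs)"
      using map_prod_inj_on[OF inj inj] path_arcs_subset by (rule inj_on_subset)
    then show ?thesis
      using inj assms T.wf_digraph_axioms unfolding T.digraph_isomorphism_def f_def by auto
  qed
  moreover have "with_proj (path_graph N) = app_iso f (with_proj T)"
  proof -
    have "g ` set xs = {1..N}" using map by (metis set_map atLeastLessThanSuc_atLeastAtMost set_upt)
    moreover have "map_prod g g ` path_arcs xs = parcs (path_graph N)"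
      using map path_arcs_upt by (metis path_arcs_map)
    ultimately show ?thesis
      using assms by (simp add: with_proj_def app_iso_def f_def path_graph_def)
  qed
  ultimately show ?thesis unfolding digraph_iso_def by blast
qed

section \<open>The path graph is a tree\<close>

lemma connected_path_graph:
  assumes "1 \<le> N"
  shows "Digraph_Component.connected (with_proj (path_graph N))"
proof -
  interpret pair_graph "path_graph N" by (rule pair_graph_path_graph)
  have reach: "1 \<rightarrow>\<^sup>*\<^bsub>with_proj (path_graph N)\<^esub> v" if "v \<in> {1..N}" for v
    using that
  proof (induction v)
    case (Suc v)
    show ?case
    proof (cases "v = 0")
      case True
      have "1 \<in> pverts (path_graph N)" using assms by (simp add: path_graph_def)
      then have "1 \<rightarrow>\<^sup>*\<^bsub>with_proj (path_graph N)\<^esub> 1" by (rule reachable_refl)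
      then show ?thesis using True by simp
    next
      case False
      then have "1 \<rightarrow>\<^sup>*\<^bsub>with_proj (path_graph N)\<^esub> v" using Suc by auto
      moreover have "(v, Suc v) \<in> parcs (path_graph N)"
        using False Suc.prems by (auto simp: path_graph_def)
      ultimately show ?thesis by (rule reachable_adj_trans)
    qed
  qed simp
  then have "u \<rightarrow>\<^sup>*\<^bsub>with_proj (path_graph N)\<^esub> v" if "u \<in> {1..N}" "v \<in> {1..N}" for u v
    using that reachable_trans symmetric_reachable' by blast
  then have "strongly_connected (with_proj (path_graph N))"
    using assms unfolding strongly_connected_def by (auto simp: path_graph_def)
  \<comment> \<open>Connectedness concerns the symmetric closure, which contains the arcs
    themselves.\<close>
  then show ?thesis
    by (auto simp: connected_conv strongly_connected_def reachable_def symcl_def intro: rtrancl_on_mono)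
qed

text \<open>A discrete intermediate value argument: each arc moves by one, so changing sides means
  visiting \<open>w\<close>.\<close>

lemma path_graph_walk_crosses:
  assumes "pcas x p y" "set p \<subseteq> parcs (path_graph N)" "w \<notin> set (pawalk_verts x p)"
  shows "w < x \<longleftrightarrow> w < y"
  using assms
proof (induction p arbitrary: x)
  case (Cons e p)
  then have "w < snd e \<longleftrightarrow> w < y" by simp
  moreover have "w \<noteq> snd e" using Cons.prems by (cases p) auto
  moreover have "w \<noteq> x" "fst e = x" "snd e = x + 1 \<or> x = snd e + 1"
    using Cons.prems by (auto simp: path_graph_def)
  ultimately show ?case by linarith
qed simp

text \<open>
  A cycle of length at least 3 that starts with the arcs \<open>(u, w)\<close>, \<open>(w, x)\<close> has \<open>u\<close> and \<open>x\<close> on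
  different sides of \<open>w\<close>, so it cannot return from \<open>x\<close> to \<open>u\<close> without passing through \<open>w\<close> again.
\<close>
lemma path_graph_acyclic:
  assumes "pre_digraph.cycle (with_proj (path_graph N)) p"
  shows "length p < 3"
proof (rule ccontr)
  interpret pair_graph "path_graph N" by (rule pair_graph_path_graph)
  assume "\<not> length p < 3"
  then obtain e1 e2 q where p: "p = e1 # e2 # q" and "q \<noteq> []"
    by (cases p; cases "tl p") auto
  obtain u w x where e: "e1 = (u, w)" "e2 = (w, x)"
    and q: "pcas x q u" "set q \<subseteq> parcs (path_graph N)"
    and arcs: "(u, w) \<in> parcs (path_graph N)" "(w, x) \<in> parcs (path_graph N)"
    and dist: "distinct (pawalk_verts x q)" "w \<notin> set (pawalk_verts x q)"
    using assms p by (cases e1; cases e2) (auto simp: cycle_def awalk_def)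
  have "u \<noteq> x"
    using apath_nonempty_ends[of x q u] q dist \<open>q \<noteq> []\<close> in_arcsD2[OF arcs(2)]
    by (auto simp: apath_def awalk_def)
  moreover have "w < x \<longleftrightarrow> w < u" using q dist(2) by (rule path_graph_walk_crosses)
  ultimately show False using arcs by (auto simp: path_graph_def)
qed

lemma undirected_tree_path_graph: "1 \<le> N \<Longrightarrow> undirected_tree (path_graph N)"
  using path_graph_acyclic
  by (auto simp: undirected_tree_def pair_graph_path_graph connected_path_graph not_le)

section \<open>Coloring counts of paths and trees\<close>

lemma tree_on_path_graph:
  assumes "1 \<le> N"
  shows "tree_on (chain (N - 1)) 1 (pverts (path_graph N)) (parcs (path_graph N))"
proof -
  have "hd [1..<Suc N] = 1" using assms by (simp add: hd_append)
  moreover have "set [1..<Suc N] = pverts (path_graph N)" by (auto simp: path_graph_def)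
  ultimately show ?thesis
    using tree_on_chain_path[of "[1..<Suc N]"] assms path_arcs_upt[of N] by (simp del: upt_Suc)
qed

lemma hom_count_path_graph:
  assumes "1 \<le> N"
  shows "int (hom_count (path_graph N) (looped_path n)) = (\<Sum>i=1..n. weight (looped_path n) (chain (N - 1)) i)"
  using pair_pseudo_graph.hom_count_tree_on[OF pair_pseudo_graph_looped_path tree_on_path_graph[OF assms], of n]
  by simp

lemma trees_tree_on:
  assumes "T \<in> trees N" "1 \<le> N"
  obtains t where "tree_on t 1 (pverts T) (parcs T)" "nodes t = Suc (N - 1)"
    "int (hom_count T (looped_path n)) = (\<Sum>i=1..n. weight (looped_path n) t i)"
proof -
  have T: "undirected_tree T" "pverts T = {1..N}" using assms by (auto simp: trees_def)
  then obtain t where t: "tree_on t 1 (pverts T) (parcs T)"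
    using tree_on_undirected_tree[of T 1] assms(2) by auto
  with tree_on_card[OF t] T(2) assms(2)
    pair_pseudo_graph.hom_count_tree_on[OF pair_pseudo_graph_looped_path t, of n]
  show ?thesis by (intro that) auto
qed

lemma hom_count_path_graph_le:
  assumes "T \<in> trees N" "1 \<le> N"
  shows "hom_count (path_graph N) (looped_path n) \<le> hom_count T (looped_path n)"
proof -
  obtain t where "nodes t = Suc (N - 1)"
    "int (hom_count T (looped_path n)) = (\<Sum>i=1..n. weight (looped_path n) t i)"
    using trees_tree_on[OF assms] by metis
  then show ?thesis
    using sum_weight_chain_le[OF centred_1, of t "N - 1" n] hom_count_path_graph[OF assms(2), of n]
    by simp
qed

lemma hom_count_path_graph_less:
  assumes "T \<in> trees N" "1 \<le> N" "3 \<le> n" "\<not> digraph_iso (with_proj T) (with_proj (path_graph N))"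
  shows "hom_count (path_graph N) (looped_path n) < hom_count T (looped_path n)"
proof -
  obtain t where t: "tree_on t 1 (pverts T) (parcs T)" "nodes t = Suc (N - 1)"
    and hom: "int (hom_count T (looped_path n)) = (\<Sum>i=1..n. weight (looped_path n) t i)"
    using trees_tree_on[OF assms(1,2)] by metis
  interpret T: pair_graph T using assms(1) by (simp add: trees_def undirected_tree_def)
  have V: "pverts T = {1..N}" using assms(1) by (simp add: trees_def)
  \<comment> \<open>Listing the vertices of \<open>T\<close> along a path would give the excluded
    isomorphism.\<close>
  have not_path: False if "distinct xs" "pverts T = set xs" "parcs T = path_arcs xs" for xs
    using digraph_iso_path_graph[OF T.pair_wf_digraph that(2,3,1)] assms(4) V
      distinct_card[OF that(1)] that(2) by simp
  have "t \<noteq> Root"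
  proof
    assume "t = Root"
    \<comment> \<open>\<open>Root\<close> is \<open>chain 0\<close>, the path on one vertex.\<close>
    then have "tree_on (chain 0) 1 (pverts T) (parcs T)" using t(1) by simp
    then obtain xs where "distinct xs" "pverts T = set xs" "parcs T = path_arcs xs"
      using tree_on_chainD[of 0 1 "pverts T" "parcs T"] by blast
    then show False by (rule not_path)
  qed
  moreover have "t \<noteq> Graft (chain p) (chain q)" for p q
  proof
    assume "t = Graft (chain p) (chain q)"
    then have "tree_on (Graft (chain p) (chain q)) 1 (pverts T) (parcs T)" using t(1) by simp
    from tree_on_Graft_chainsD[OF this] obtain xs where
      "distinct xs" "pverts T = set xs" "parcs T = path_arcs xs" by blast
    then show False by (rule not_path)
  qed
  ultimately show ?thesis
    using sum_weight_chain_less_unrooted[OF assms(3) t(2)] hom hom_count_path_graph[OF assms(2), of n]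
    by simp
qed

theorem theorem4p7:
  shows "(\<forall>n\<ge>1. Hoffman_London (looped_path n)) \<and>
         (\<forall>n\<ge>3. strongly_Hoffman_London (looped_path n))"
proof (intro conjI allI impI)
  fix n :: nat
  show "Hoffman_London (looped_path n)"
    unfolding Hoffman_London_def
  proof (intro allI impI)
    fix N :: nat
    assume N: "1 \<le> N"
    \<comment> \<open>Membership turns the lower bound into an attained minimum.\<close>
    have "path_graph N \<in> trees N"
      using undirected_tree_path_graph[OF N] by (simp add: trees_def path_graph_def)
    then show "hom_count (path_graph N) (looped_path n)
        = Min ((\<lambda>T. hom_count T (looped_path n)) ` trees N)"
      using hom_count_path_graph_le[OF _ N] finite_trees[of N]
      by (intro Min_eqI[symmetric]) auto
  qed
next
  fix n :: nat
  assume "3 \<le> n"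
  then show "strongly_Hoffman_London (looped_path n)"
    unfolding strongly_Hoffman_London_def by (blast intro: hom_count_path_graph_less)
qed

end
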